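(* Let $\Omega$ be a smoothly bounded, convex domain in $\mathbb{C}^n$, and let $\delta$ be the signed distance function to $b\Omega$ (negative in $\Omega$). Then there exists a neighborhood $U$ of $b\Omega$ such that $\delta(z)$ is a convex function for $z\in U\cap\Omega$; that is, the real Hessian satisfies $\mathcal{H}_{\delta(z)}(W,W)\geq 0$ for all $z\in U\cap\Omega$ and all $W\in\mathbb{C}^n\cong\mathbb{R}^{2n}$.
   Context: A smoothly bounded domain $\Omega\subset\mathbb{C}^n$ is a bounded domain with smooth ($C^\infty$) boundary $b\Omega$. A local defining function for $\Omega$ in a neighborhood $U$ of $p\in b\Omega$ is a real-valued $r\in C^\infty(U)$ with $U\cap\Omega=\{z\in U: r(z)<0\}$ and $\nabla r(z)\neq 0$ for $z\in U$. Identify $\mathbb{C}^n$ with $\mathbb{R}^{2n}$ via $z_k=x_{2k-1}+i\,x_{2k}$, $k=1,\dots,n$. For a real-valued $C^2$ function $f$, the real Hessian at $p$ is $\mathcal{H}_{f(p)}(A,B)=\sum_{k,\ell=1}^{2n}\frac{\partial^2 f}{\partial x_k\partial x_\ell}(p)\,a_k b_\ell$, where $(a_k)$ and $(b_\ell)$ are the real coordinates of $A,B$. The real tangent space to $b\Omega$ at $p\in b\Omega$ is $\mathbb{R}T_p(b\Omega)=\{W\in\mathbb{R}^{2n}:\sum_{k=1}^{2n}\frac{\partial r}{\partial x_k}(p)W_k=0\}$ (independent of the choice of local defining function $r$). $\Omega$ is called convex if near each boundary point, for a local defining function $r$, one has $\mathcal{H}_{r(p)}(V,V)\geq 0$ for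 all $p\in b\Omega$ near that point and all $V\in\mathbb{R}T_p(b\Omega)$ (this is independent of the choice of $r$). The signed distance function is $\delta(z)=-d(z)$ for $z\in\Omega$ and $\delta(z)=d(z)$ for $z\in\mathbb{C}^n\setminus\Omega$, where $d(z)=\inf_{q\in b\Omega}\|z-q\|$ is the Euclidean distance to $b\Omega$. It is smooth in some neighborhood of $b\Omega$. A $C^2$ function is called convex at a point if its real Hessian is non-negative definite at all points of some neighborhood of that point. *)

theory Defs
  imports "HOL-Analysis.Analysis"
begin

text \<open>
  The real coordinates of a point \<open>z\<close> of a Euclidean space are the inner products \<open>z \<bullet> b\<close>
  with \<open>b \<in> Basis\<close>.  On \<^typ>\<open>complex ^ 'n\<close> these are exactly the real and imaginary parts of the
  components, i.e. the usual identification of $\mathbb{C}^n$ with $\mathbb{R}^{2n}$.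
\<close>

lemma Basis_complex_vec:
  "(Basis :: (complex ^ 'n) set) = (\<Union>k. {axis k 1, axis k \<i>})"
  by (auto simp: Basis_vec_def Basis_complex_def)

lemma real_coordinates_complex_vec:
  fixes z :: "complex ^ 'n"
  shows "z \<bullet> axis k 1 = Re (z $ k)" and "z \<bullet> axis k \<i> = Im (z $ k)"
  by (simp_all add: inner_axis inner_complex_def)

definition partial_deriv :: "'a::euclidean_space \<Rightarrow> ('a \<Rightarrow> real) \<Rightarrow> 'a \<Rightarrow> real" where
  "partial_deriv b f p = deriv (\<lambda>t::real. f (p + t *\<^sub>R b)) 0"

definition grad :: "('a::euclidean_space \<Rightarrow> real) \<Rightarrow> 'a \<Rightarrow> 'a" where
  "grad f p = (\<Sum>b\<in>Basis. partial_deriv b f p *\<^sub>R b)"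

definition real_Hessian :: "('a::euclidean_space \<Rightarrow> real) \<Rightarrow> 'a \<Rightarrow> 'a \<Rightarrow> 'a \<Rightarrow> real" where
  "real_Hessian f p A B =
     (\<Sum>b\<in>Basis. \<Sum>c\<in>Basis. partial_deriv b (partial_deriv c f) p * (A \<bullet> b) * (B \<bullet> c))"

text \<open>
  \<open>Ck_on k f U\<close>: \<open>f\<close> is of class $C^k$ on \<open>U\<close>.  It is only meant, and only used, for open \<open>U\<close>.
\<close>

fun Ck_on :: "nat \<Rightarrow> ('a::euclidean_space \<Rightarrow> real) \<Rightarrow> 'a set \<Rightarrow> bool" where
  "Ck_on 0 f U \<longleftrightarrow> continuous_on U f"
| "Ck_on (Suc k) f U \<longleftrightarrow>
     (\<forall>x\<in>U. f differentiable (at x)) \<and> (\<forall>b\<in>Basis. Ck_on k (partial_deriv b f) U)"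

definition smooth_on :: "('a::euclidean_space \<Rightarrow> real) \<Rightarrow> 'a set \<Rightarrow> bool" where
  "smooth_on f U \<longleftrightarrow> (\<forall>k. Ck_on k f U)"

definition local_defining_function ::
    "'a::euclidean_space set \<Rightarrow> 'a \<Rightarrow> 'a set \<Rightarrow> ('a \<Rightarrow> real) \<Rightarrow> bool" where
  "local_defining_function \<Omega> p U r \<longleftrightarrow>
     open U \<and> p \<in> U \<and> smooth_on r U \<and> U \<inter> \<Omega> = {z \<in> U. r z < 0} \<and> (\<forall>z\<in>U. grad r z \<noteq> 0)"

definition smoothly_bounded_domain :: "'a::euclidean_space set \<Rightarrow> bool" where
  "smoothly_bounded_domain \<Omega> \<longleftrightarrow>
     open \<Omega> \<and> connected \<Omega> \<and> \<Omega> \<noteq> {} \<and> bounded \<Omega> \<and>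
     (\<forall>p\<in>frontier \<Omega>. \<exists>U r. local_defining_function \<Omega> p U r)"

definition real_tangent_space :: "('a::euclidean_space \<Rightarrow> real) \<Rightarrow> 'a \<Rightarrow> 'a set" where
  "real_tangent_space r p = {W. (\<Sum>b\<in>Basis. partial_deriv b r p * (W \<bullet> b)) = 0}"

text \<open>
  Convexity of a domain is the infinitesimal condition on the boundary, not the library's
  \<^const>\<open>convex\<close> for sets.
\<close>

definition convex_domain :: "'a::euclidean_space set \<Rightarrow> bool" where
  "convex_domain \<Omega> \<longleftrightarrow>
     (\<forall>p\<in>frontier \<Omega>. \<exists>U r. local_defining_function \<Omega> p U r \<and>
        (\<forall>q \<in> frontier \<Omega> \<inter> U. \<forall>V \<in> real_tangent_space r q. real_Hessian r q V V \<ge> 0))"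

definition signed_distance :: "'a::euclidean_space set \<Rightarrow> 'a \<Rightarrow> real" where
  "signed_distance \<Omega> z =
     (if z \<in> \<Omega> then - infdist z (frontier \<Omega>) else infdist z (frontier \<Omega>))"

text \<open>
  Regularity of class $C^2$ is part of the notion, so that the Hessian is meaningful.
\<close>

definition convex_function_at :: "('a::euclidean_space \<Rightarrow> real) \<Rightarrow> 'a \<Rightarrow> bool" where
  "convex_function_at f p \<longleftrightarrow>
     (\<exists>V. open V \<and> p \<in> V \<and> Ck_on 2 f V \<and> (\<forall>q\<in>V. \<forall>W. real_Hessian f q W W \<ge> 0))"

end

theory Submission
  imports Defs
begin

text \<open>
  Let \<open>r\<close> be a defining function near \<open>p\<close>, \<open>g\<close> its gradient and \<open>A\<close> its second derivative. By the
  inverse function theorem \<open>(q, t) \<mapsto> (q + t g(q), r(q))\<close> is a local diffeomorphism at \<open>(p, 0)\<close>, and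
  the nearest boundary point \<open>\<pi>(z)\<close> of \<open>z\<close> satisfies \<open>z = \<pi>(z) + \<tau>(z) g(\<pi>(z))\<close>; so \<open>\<pi>\<close> and \<open>\<tau>\<close> are
  \<open>C\<^sup>1\<close>. The signed distance has the unit normal at \<open>\<pi>(z)\<close> as gradient, hence it is \<open>C\<^sup>2\<close>.

  With \<open>V = d\<pi>(W)\<close>, differentiating \<open>z = \<pi> + \<tau> g(\<pi>)\<close> gives \<open>W = V + c u + \<tau> A V\<close>, where \<open>u\<close> is the unit
  normal, and up to the factor \<open>\<parallel>g\<parallel>\<close> the Hessian of the distance at \<open>(W, W)\<close> is
  \<open>A V \<bullet> V + \<tau> \<parallel>X\<parallel>\<^sup>2\<close>, with \<open>X\<close> the tangential part of \<open>A V\<close>. Inside the domain \<open>\<tau> < 0\<close>, but positivity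
  of \<open>A\<close> at the tangent vector \<open>V + \<tau> X\<close> makes this nonnegative as soon as \<open>\<bar>\<tau>\<bar> \<parallel>A\<parallel> \<le> 1\<close>.
\<close>

section \<open>Functions of class $C^2$\<close>

lemma partial_deriv_eq:
  assumes "(f has_derivative f') (at x)"
  shows "partial_deriv b f x = f' b"
proof -
  have "(f has_derivative f') (at (x + 0 *\<^sub>R b))"
    using assms by simp
  moreover have "((\<lambda>t::real. x + t *\<^sub>R b) has_derivative (\<lambda>t. t *\<^sub>R b)) (at 0)"
    by (auto intro!: derivative_eq_intros)
  ultimately have "((\<lambda>t. f (x + t *\<^sub>R b)) has_derivative (\<lambda>t. f' (t *\<^sub>R b))) (at 0)"
    by (rule has_derivative_compose[rotated])
  moreover have "f' (t *\<^sub>R b) = f' b * t" for t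
    using has_derivative_linear[OF assms] by (simp add: linear_cmul)
  ultimately have "((\<lambda>t. f (x + t *\<^sub>R b)) has_field_derivative f' b) (at 0)"
    by (simp add: has_field_derivative_def)
  then show ?thesis
    unfolding partial_deriv_def by (rule DERIV_imp_deriv)
qed

lemma partial_deriv_cong:
  assumes "open U" "x \<in> U" "\<And>y. y \<in> U \<Longrightarrow> f y = g y"
  shows "partial_deriv b f x = partial_deriv b g x"
proof -
  have "((\<lambda>t::real. x + t *\<^sub>R b) \<longlongrightarrow> x + 0 *\<^sub>R b) (nhds 0)"
    by (intro tendsto_intros filterlim_ident)
  then have "\<forall>\<^sub>F t::real in nhds 0. x + t *\<^sub>R b \<in> U"
    using assms(1,2) by (auto dest: topological_tendstoD)
  then have "\<forall>\<^sub>F t::real in nhds 0. f (x + t *\<^sub>R b) = g (x + t *\<^sub>R b)"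
    by eventually_elim (rule assms(3))
  then show ?thesis
    unfolding partial_deriv_def by (intro deriv_cong_ev) auto
qed

text \<open>Since \<open>U\<close> is open, a partial derivative at a point of \<open>U\<close>
  depends only on values in \<open>U\<close>, so agreement passes from each order to the next.
  Partial derivatives can thus be replaced by formulas that hold on \<open>U\<close> only.\<close>

lemma Ck_on_cong:
  assumes "open U" "\<And>x. x \<in> U \<Longrightarrow> f x = g x"
  shows "Ck_on k f U \<longleftrightarrow> Ck_on k g U"
  using assms(2)
proof (induction k arbitrary: f g)
  case 0
  then show ?case by (auto cong: continuous_on_cong)
next
  case (Suc k)
  have "f differentiable (at x) \<longleftrightarrow> g differentiable (at x)" if "x \<in> U" for x
    using has_derivative_transform_within_open[OF _ \<open>open U\<close> that, of f _ UNIV g]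
      has_derivative_transform_within_open[OF _ \<open>open U\<close> that, of g _ UNIV f] Suc.prems
    unfolding differentiable_def by metis
  moreover have "Ck_on k (partial_deriv b f) U \<longleftrightarrow> Ck_on k (partial_deriv b g) U" for b
    by (rule Suc.IH) (rule partial_deriv_cong[OF \<open>open U\<close> _ Suc.prems])
  ultimately show ?case by simp
qed

text \<open>The bridge from total derivatives to the coordinate definitions: first partials are
  coordinates of \<open>g x\<close>, second partials are the matrix entries
  \<open>D x b \<bullet> c\<close>. In \<open>real_Hessian\<close> the first vector goes with the
  outer derivative, which gives \<open>D x A \<bullet> B\<close> in this order without using
  symmetry.\<close>

lemma Ck_on_2I:
  fixes f :: "'a::euclidean_space \<Rightarrow> real"
  assumes U: "open U"
    and f: "\<And>x. x \<in> U \<Longrightarrow> (f has_derivative (\<lambda>h. g x \<bullet> h)) (at x)"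
    and g: "\<And>x. x \<in> U \<Longrightarrow> (g has_derivative D x) (at x)"
    and D: "\<And>b. b \<in> Basis \<Longrightarrow> continuous_on U (\<lambda>x. D x b)"
  shows "Ck_on 2 f U"
    and "x \<in> U \<Longrightarrow> real_Hessian f x A B = D x A \<bullet> B"
proof -
  have 1: "partial_deriv c f x = g x \<bullet> c" if "x \<in> U" for x c
    using partial_deriv_eq[OF f[OF that]] .
  have gc: "((\<lambda>x. g x \<bullet> c) has_derivative (\<lambda>h. D x h \<bullet> c)) (at x)" if "x \<in> U" for x c
    using g[OF that] by (rule has_derivative_inner_left)
  have 2: "partial_deriv b (\<lambda>x. g x \<bullet> c) x = D x b \<bullet> c" if "x \<in> U" for x b c
    using partial_deriv_eq[OF gc[OF that]] .
  have "Ck_on 1 (\<lambda>x. g x \<bullet> c) U" for c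
  proof -
    have "Ck_on 0 (partial_deriv b (\<lambda>x. g x \<bullet> c)) U" if "b \<in> Basis" for b
      using D[OF that] by (auto simp: 2 intro!: continuous_intros cong: continuous_on_cong)
    then show ?thesis
      using gc by (auto simp: differentiable_def)
  qed
  then have "Ck_on 1 (partial_deriv c f) U" for c
    using Ck_on_cong[OF U, of "partial_deriv c f" "\<lambda>x. g x \<bullet> c" 1 for c] 1 by blast
  moreover have "f differentiable (at x)" if "x \<in> U" for x
    using f[OF that] by (rule differentiableI)
  ultimately show "Ck_on 2 f U"
    by (simp add: numeral_2_eq_2)
  show "real_Hessian f x A B = D x A \<bullet> B" if x: "x \<in> U"
  proof -
    interpret D: linear "D x" using g[OF x] by (rule has_derivative_linear)
    have "partial_deriv b (partial_deriv c f) x = D x b \<bullet> c" for b c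
      using partial_deriv_cong[OF U x 1] 2[OF x] by simp
    then have "real_Hessian f x A B = (\<Sum>b\<in>Basis. \<Sum>c\<in>Basis. (D x b \<bullet> c) * (A \<bullet> b) * (B \<bullet> c))"
      by (simp add: real_Hessian_def)
    also have "\<dots> = (\<Sum>b\<in>Basis. (A \<bullet> b) * (D x b \<bullet> B))"
      by (subst (3) euclidean_inner) (simp add: sum_distrib_left ac_simps)
    also have "\<dots> = D x (\<Sum>b\<in>Basis. (A \<bullet> b) *\<^sub>R b) \<bullet> B"
      by (simp add: D.sum D.scale inner_sum_left)
    finally show ?thesis by (simp add: euclidean_representation)
  qed
qed

lemma has_derivative_grad:
  fixes f :: "'a::euclidean_space \<Rightarrow> real"
  assumes "f differentiable (at x)"
  shows "(f has_derivative (\<lambda>h. grad f x \<bullet> h)) (at x)"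
proof -
  obtain f' where f': "(f has_derivative f') (at x)"
    using assms by (auto simp: differentiable_def)
  interpret linear f' using f' by (rule has_derivative_linear)
  have "grad f x \<bullet> h = f' h" for h
  proof -
    have "f' h = f' (\<Sum>b\<in>Basis. (h \<bullet> b) *\<^sub>R b)" by (simp add: euclidean_representation)
    also have "\<dots> = (\<Sum>b\<in>Basis. (h \<bullet> b) * f' b)" by (simp add: sum scale)
    finally show ?thesis
      by (simp add: grad_def partial_deriv_eq[OF f'] inner_sum_left inner_commute[of h] mult.commute)
  qed
  then show ?thesis using f' by simp
qed

text \<open>The converse bridge. The gradients of the first partials are the rows of
  \<open>D x\<close>. Continuity on each basis vector is continuity in operator norm in finite
  dimension, and this is the form that the inverse function theorem requires.\<close>

lemma Ck_on_2E:
  fixes f :: "'a::euclidean_space \<Rightarrow> real"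
  assumes U: "open U" and f: "Ck_on 2 f U"
  obtains D :: "'a \<Rightarrow> 'a \<Rightarrow>\<^sub>L 'a"
  where "\<And>x. x \<in> U \<Longrightarrow> (f has_derivative (\<lambda>h. grad f x \<bullet> h)) (at x)"
    and "\<And>x. x \<in> U \<Longrightarrow> (grad f has_derivative D x) (at x)"
    and "continuous_on U D"
proof -
  define D' where "D' x h = (\<Sum>b\<in>Basis. (grad (partial_deriv b f) x \<bullet> h) *\<^sub>R b)" for x h
  have bl: "bounded_linear (D' x)" for x
    unfolding D'_def by (intro bounded_linear_intros)
  have 1: "partial_deriv b f differentiable at x" if "b \<in> Basis" "x \<in> U" for b x
    using f that by (simp add: numeral_2_eq_2)
  have 2: "continuous_on U (partial_deriv c (partial_deriv b f))"
    if "b \<in> Basis" "c \<in> Basis" for b c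
    using f that by (simp add: numeral_2_eq_2)
  show ?thesis
  proof
    show "(f has_derivative (\<lambda>h. grad f x \<bullet> h)) (at x)" if "x \<in> U" for x
      using f that by (intro has_derivative_grad) (simp add: numeral_2_eq_2)
    show "(grad f has_derivative Blinfun (D' x)) (at x)" if "x \<in> U" for x
      unfolding bounded_linear_Blinfun_apply[OF bl]
      unfolding D'_def grad_def[of f, abs_def]
      by (intro has_derivative_sum has_derivative_scaleR_left has_derivative_grad 1 that)
    have "continuous_on U (\<lambda>x. D' x h)" for h
      unfolding D'_def grad_def
      by (intro continuous_intros 2)
    then show "continuous_on U (\<lambda>x. Blinfun (D' x))"
      by (intro continuous_on_blinfun_componentwise)
         (simp add: bounded_linear_Blinfun_apply[OF bl])
  qed
qed

section \<open>Symmetry of the second derivative\<close>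

lemma second_difference_mvt:
  fixes f :: "'a::real_inner \<Rightarrow> real"
  assumes f: "\<And>y. y \<in> ball x e \<Longrightarrow> (f has_derivative (\<lambda>v. g y \<bullet> v)) (at y)"
    and g: "\<And>y. y \<in> ball x e \<Longrightarrow> (g has_derivative D y) (at y)"
    and s: "0 < s" "s * (norm h + norm k) < e"
  obtains y where "y \<in> ball x e"
    "f (x + s *\<^sub>R h + s *\<^sub>R k) - f (x + s *\<^sub>R h) - f (x + s *\<^sub>R k) + f x = s\<^sup>2 * (D y k \<bullet> h)"
proof -
  have ball: "x + u *\<^sub>R h + v *\<^sub>R k \<in> ball x e" if "0 \<le> u" "u \<le> s" "0 \<le> v" "v \<le> s" for u v
  proof -
    have "norm (u *\<^sub>R h + v *\<^sub>R k) \<le> u * norm h + v * norm k"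
      using norm_triangle_ineq[of "u *\<^sub>R h" "v *\<^sub>R k"] that by simp
    also have "\<dots> \<le> s * norm h + s * norm k"
      by (intro add_mono mult_right_mono that) auto
    finally show ?thesis
      using s(2) by (simp add: dist_norm norm_minus_commute algebra_simps)
  qed
  have df: "((\<lambda>u. f (x + u *\<^sub>R h + v *\<^sub>R k)) has_field_derivative g (x + u *\<^sub>R h + v *\<^sub>R k) \<bullet> h) (at u)"
    if "0 \<le> u" "u \<le> s" "0 \<le> v" "v \<le> s" for u v
  proof -
    have "((\<lambda>u. x + u *\<^sub>R h + v *\<^sub>R k) has_derivative (\<lambda>t. t *\<^sub>R h)) (at u)"
      by (auto intro!: derivative_eq_intros)
    from has_derivative_compose[OF this f[OF ball[OF that]]] show ?thesis
      by (simp add: has_field_derivative_def mult_commute_abs)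
  qed
  have dg: "((\<lambda>v. g (x + u *\<^sub>R h + v *\<^sub>R k) \<bullet> h) has_field_derivative
      D (x + u *\<^sub>R h + v *\<^sub>R k) k \<bullet> h) (at v)"
    if "0 \<le> u" "u \<le> s" "0 \<le> v" "v \<le> s" for u v
  proof -
    have "((\<lambda>v. x + u *\<^sub>R h + v *\<^sub>R k) has_derivative (\<lambda>t. t *\<^sub>R k)) (at v)"
      by (auto intro!: derivative_eq_intros)
    note g' = g[OF ball[OF that]]
    from has_derivative_inner_left[OF has_derivative_compose[OF \<open>(_ has_derivative (\<lambda>t. t *\<^sub>R k)) _\<close> g'], of h]
    show ?thesis
      using linear_cmul[OF has_derivative_linear[OF g']]
      by (simp add: has_field_derivative_def mult_commute_abs)
  qed
  \<comment> \<open>The mean value theorem in \<open>u\<close> is applied to the difference of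
    \<open>f\<close> along two parallel segments, then in \<open>v\<close> to the resulting
    difference of gradients. The summands with factor \<open>0\<close> keep the shape of
    \<open>df\<close>.\<close>
  have "\<exists>u. 0 < u \<and> u < s \<and>
      (f (x + s *\<^sub>R h + s *\<^sub>R k) - f (x + s *\<^sub>R h + 0 *\<^sub>R k))
      - (f (x + 0 *\<^sub>R h + s *\<^sub>R k) - f (x + 0 *\<^sub>R h + 0 *\<^sub>R k))
      = (s - 0) * (g (x + u *\<^sub>R h + s *\<^sub>R k) \<bullet> h - g (x + u *\<^sub>R h + 0 *\<^sub>R k) \<bullet> h)"
    using s(1) by (intro MVT2 DERIV_diff df) auto
  then obtain u where u: "0 < u" "u < s"
    and 1: "f (x + s *\<^sub>R h + s *\<^sub>R k) - f (x + s *\<^sub>R h) - f (x + s *\<^sub>R k) + f x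
      = s * (g (x + u *\<^sub>R h + s *\<^sub>R k) \<bullet> h - g (x + u *\<^sub>R h + 0 *\<^sub>R k) \<bullet> h)"
    by (auto simp: algebra_simps)
  have "\<exists>v. 0 < v \<and> v < s \<and> g (x + u *\<^sub>R h + s *\<^sub>R k) \<bullet> h - g (x + u *\<^sub>R h + 0 *\<^sub>R k) \<bullet> h
      = (s - 0) * (D (x + u *\<^sub>R h + v *\<^sub>R k) k \<bullet> h)"
    using s(1) u by (intro MVT2 dg) auto
  then obtain v where v: "0 < v" "v < s"
    and 2: "g (x + u *\<^sub>R h + s *\<^sub>R k) \<bullet> h - g (x + u *\<^sub>R h + 0 *\<^sub>R k) \<bullet> h
      = s * (D (x + u *\<^sub>R h + v *\<^sub>R k) k \<bullet> h)"
    by auto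
  show ?thesis
    by (rule that[OF ball[of u v]]) (use u v 1 2 in \<open>auto simp: power2_eq_square\<close>)
qed

text \<open>The second difference of \<open>f\<close> does not change when \<open>h\<close> and
  \<open>k\<close> are swapped, and by the mean value theorem it is \<open>s\<^sup>2\<close> times
  either mixed term at some point near \<open>x\<close>. Continuity of \<open>D\<close> moves both
  points to \<open>x\<close>.\<close>

lemma second_derivative_symmetric:
  fixes f :: "'a::real_inner \<Rightarrow> real" and D :: "'a \<Rightarrow> 'a \<Rightarrow>\<^sub>L 'a"
  assumes U: "open U" "x \<in> U"
    and f: "\<And>y. y \<in> U \<Longrightarrow> (f has_derivative (\<lambda>v. g y \<bullet> v)) (at y)"
    and g: "\<And>y. y \<in> U \<Longrightarrow> (g has_derivative D y) (at y)"
    and D: "continuous_on U D"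
  shows "D x h \<bullet> k = D x k \<bullet> h"
proof -
  have "\<bar>D x h \<bullet> k - D x k \<bullet> h\<bar> \<le> 2 * \<epsilon>" if "\<epsilon> > 0" for \<epsilon> :: real
  proof -
    have c: "isCont (\<lambda>y. D y v \<bullet> w) x" for v w
    proof -
      have "continuous_on U (\<lambda>y. D y v \<bullet> w)"
        by (intro continuous_intros D)
      then show ?thesis using U by (simp add: continuous_on_eq_continuous_at)
    qed
    obtain e1 where e1: "e1 > 0" "ball x e1 \<subseteq> U"
      using U by (auto simp: open_contains_ball)
    obtain e2 where e2: "e2 > 0" "\<And>y. dist y x < e2 \<Longrightarrow> dist (D y h \<bullet> k) (D x h \<bullet> k) < \<epsilon>"
      using c[of h k] \<open>\<epsilon> > 0\<close> unfolding continuous_at_eps_delta by blast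
    obtain e3 where e3: "e3 > 0" "\<And>y. dist y x < e3 \<Longrightarrow> dist (D y k \<bullet> h) (D x k \<bullet> h) < \<epsilon>"
      using c[of k h] \<open>\<epsilon> > 0\<close> unfolding continuous_at_eps_delta by blast
    define e where "e = min e1 (min e2 e3)"
    have e: "e > 0" "ball x e \<subseteq> U" using e1 e2 e3 by (auto simp: e_def)
    \<comment> \<open>Small enough for the parallelogram with sides \<open>s *\<^sub>R h\<close> and
      \<open>s *\<^sub>R k\<close> to stay in \<open>ball x e\<close>; the summand \<open>1\<close>
      excludes division by zero.\<close>
    define s where "s = e / (norm h + norm k + 1)"
    have pos: "norm h + norm k + 1 > 0" by (smt (verit) norm_ge_zero)
    have s: "s > 0" using e pos by (simp add: s_def)
    have s': "s * (norm h + norm k) < e"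
      using e pos by (simp add: s_def field_simps)
    obtain y1 where y1: "y1 \<in> ball x e"
      "f (x + s *\<^sub>R h + s *\<^sub>R k) - f (x + s *\<^sub>R h) - f (x + s *\<^sub>R k) + f x = s\<^sup>2 * (D y1 k \<bullet> h)"
      by (rule second_difference_mvt[where f=f and g=g and D="\<lambda>y. blinfun_apply (D y)" and h=h and k=k, OF _ _ s s'])
         (use e f g in auto)
    obtain y2 where y2: "y2 \<in> ball x e"
      "f (x + s *\<^sub>R k + s *\<^sub>R h) - f (x + s *\<^sub>R k) - f (x + s *\<^sub>R h) + f x = s\<^sup>2 * (D y2 h \<bullet> k)"
      by (rule second_difference_mvt[where f=f and g=g and D="\<lambda>y. blinfun_apply (D y)" and h=k and k=h, OF _ _ s])
         (use e f g s' in \<open>auto simp: add.commute\<close>)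
    have sw: "x + s *\<^sub>R k + s *\<^sub>R h = x + s *\<^sub>R h + s *\<^sub>R k" by (simp add: algebra_simps)
    have "s\<^sup>2 * (D y1 k \<bullet> h) = s\<^sup>2 * (D y2 h \<bullet> k)"
      using y1(2) y2(2) unfolding sw by linarith
    then have "D y1 k \<bullet> h = D y2 h \<bullet> k" using s by simp
    moreover have "dist (D y2 h \<bullet> k) (D x h \<bullet> k) < \<epsilon>" "dist (D y1 k \<bullet> h) (D x k \<bullet> h) < \<epsilon>"
      using y1(1) y2(1) by (auto intro!: e2(2) e3(2) simp: e_def dist_commute[of x])
    ultimately show ?thesis by (simp add: dist_real_def)
  qed
  from this[of "\<bar>D x h \<bullet> k - D x k \<bullet> h\<bar> / 4"] show ?thesis
    by (cases "D x h \<bullet> k = D x k \<bullet> h") auto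
qed

section \<open>Normal coordinates along a hypersurface\<close>

text \<open>Near \<open>y0\<close> all \<open>L y\<close> are bounded below by the common constant
  \<open>B / 2\<close>. Applying \<open>L y\<close> to the difference of the two inverse images of
  \<open>w\<close> gives \<open>- (L y - L y0) (M y0 w)\<close>, which tends to zero; the lower
  bound transfers this to the difference itself.\<close>

lemma continuous_on_inverse_derivative:
  fixes L :: "'a::topological_space \<Rightarrow> 'b::euclidean_space \<Rightarrow>\<^sub>L 'b"
  assumes L: "continuous_on V L" and bij: "\<And>y. y \<in> V \<Longrightarrow> bij (blinfun_apply (L y))"
  shows "continuous_on V (\<lambda>y. inv (blinfun_apply (L y)) w)"
  unfolding continuous_on_def
proof
  fix y0 assume y0: "y0 \<in> V"
  define M where "M y = inv (blinfun_apply (L y))" for y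
  have LM: "L y (M y v) = v" if "y \<in> V" for y v
    using bij[OF that] by (auto simp: M_def bij_is_surj surj_f_inv_f)
  have "linear (blinfun_apply (L y0))"
    by (intro bounded_linear.linear blinfun.bounded_linear_right)
  then obtain B where B: "B > 0" "\<And>x. norm (L y0 x) \<ge> B * norm x"
    using linear_inj_bounded_below_pos[of "blinfun_apply (L y0)"] bij[OF y0] bij_is_inj by metis
  have lim: "(L \<longlongrightarrow> L y0) (at y0 within V)"
    using L y0 by (auto simp: continuous_on_def)
  have "\<forall>\<^sub>F y in at y0 within V. norm (M y w - M y0 w) \<le> 2 / B * (norm (L y - L y0) * norm (M y0 w))"
  proof -
    have "\<forall>\<^sub>F y in at y0 within V. dist (L y) (L y0) < B / 2"
      using lim B by (intro tendstoD) auto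
    moreover have "\<forall>\<^sub>F y in at y0 within V. y \<in> V"
      by (auto simp: eventually_at_topological)
    ultimately show ?thesis
    proof eventually_elim
      case (elim y)
      have below: "B / 2 * norm x \<le> norm (L y x)" for x
      proof -
        have "B * norm x \<le> norm (L y0 x)" by (rule B)
        also have "\<dots> = norm (L y x - (L y - L y0) x)" by (simp add: blinfun.diff_left)
        also have "\<dots> \<le> norm (L y x) + norm ((L y - L y0) x)" by (rule norm_triangle_ineq4)
        also have "norm ((L y - L y0) x) \<le> norm (L y - L y0) * norm x" by (rule norm_blinfun)
        also have "\<dots> \<le> B / 2 * norm x"
          using elim(1) by (intro mult_right_mono) (auto simp: dist_norm)
        finally show ?thesis by simp
      qed
      have "B / 2 * norm (M y w - M y0 w) \<le> norm (L y (M y w - M y0 w))" by (rule below)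
      also have "L y (M y w - M y0 w) = - ((L y - L y0) (M y0 w))"
        using LM elim(2) y0 by (simp add: blinfun.diff_right blinfun.diff_left)
      also have "norm \<dots> \<le> norm (L y - L y0) * norm (M y0 w)"
        by (simp add: norm_blinfun)
      finally show ?case using B by (simp add: field_simps)
    qed
  qed
  moreover have "((\<lambda>y. 2 / B * (norm (L y - L y0) * norm (M y0 w))) \<longlongrightarrow> 0) (at y0 within V)"
  proof -
    have "((\<lambda>y. 2 / B * (norm (L y - L y0) * norm (M y0 w)))
        \<longlongrightarrow> 2 / B * (norm (L y0 - L y0) * norm (M y0 w))) (at y0 within V)"
      by (intro tendsto_intros lim)
    then show ?thesis by simp
  qed
  ultimately have "((\<lambda>y. M y w - M y0 w) \<longlongrightarrow> 0) (at y0 within V)"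
    by (rule Lim_null_comparison)
  then show "((\<lambda>y. inv (blinfun_apply (L y)) w) \<longlongrightarrow> inv (blinfun_apply (L y0)) w) (at y0 within V)"
    unfolding M_def by (simp add: LIM_zero_iff)
qed

text \<open>The inverse function theorem for \<open>F\<close>, with the inverse restricted to the
  slice where the second component vanishes: there the foot \<open>\<pi> z\<close> lies on the
  hypersurface \<open>r = 0\<close>, and \<open>\<tau> z\<close> is the coordinate along the
  gradient.\<close>

lemma normal_coordinates:
  fixes r :: "'a::euclidean_space \<Rightarrow> real" and D :: "'a \<Rightarrow> 'a \<Rightarrow>\<^sub>L 'a"
  assumes U: "open U" "p \<in> U"
    and r: "\<And>x. x \<in> U \<Longrightarrow> (r has_derivative (\<lambda>h. g x \<bullet> h)) (at x)"
    and g: "\<And>x. x \<in> U \<Longrightarrow> (g has_derivative D x) (at x)"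
    and D: "continuous_on U D"
    and p: "r p = 0" "g p \<noteq> 0"
  obtains N W \<pi> \<tau> P T where
    "open N" "(p, 0) \<in> N" "N \<subseteq> U \<times> UNIV" "open W" "p \<in> W"
    "\<And>x t. (x, t) \<in> N \<Longrightarrow> norm (D x) * \<bar>t\<bar> < 1"
    "\<And>x t. (x, t) \<in> N \<Longrightarrow> r x = 0 \<Longrightarrow> \<pi> (x + t *\<^sub>R g x) = x \<and> \<tau> (x + t *\<^sub>R g x) = t"
    "\<And>z. z \<in> W \<Longrightarrow> (\<pi> z, \<tau> z) \<in> N"
    "\<And>z. z \<in> W \<Longrightarrow> \<pi> z + \<tau> z *\<^sub>R g (\<pi> z) = z"
    "\<And>z. z \<in> W \<Longrightarrow> r (\<pi> z) = 0"
    "\<And>z. z \<in> W \<Longrightarrow> (\<pi> has_derivative P z) (at z)"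
    "\<And>z. z \<in> W \<Longrightarrow> (\<tau> has_derivative T z) (at z)"
    "\<And>w. continuous_on W (\<lambda>z. P z w)"
proof -
  define F where "F x = (fst x + snd x *\<^sub>R g (fst x), r (fst x))" for x :: "'a \<times> real"
  define L where "L x h = (fst h + (snd x *\<^sub>R D (fst x) (fst h) + snd h *\<^sub>R g (fst x)), g (fst x) \<bullet> fst h)"
    for x h :: "'a \<times> real"
  have bl: "bounded_linear (L x)" for x
    unfolding L_def
    by (intro bounded_linear_Pair bounded_linear_add bounded_linear_fst bounded_linear_snd
        bounded_linear_const_scaleR bounded_linear_scaleR_const
        bounded_linear_compose[OF blinfun.bounded_linear_right bounded_linear_fst]
        bounded_linear_compose[OF bounded_linear_inner_right bounded_linear_fst])
  have cg: "continuous_on U g"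
    using g has_derivative_continuous by (blast intro: continuous_at_imp_continuous_on)
  \<comment> \<open>The smallness condition of the final curvature estimate is built into the
    domain, so that the neighbourhood \<open>N\<close> inherits it.\<close>
  define U1 where "U1 = {x \<in> U \<times> UNIV. norm (D (fst x)) * \<bar>snd x\<bar> < 1}"
  have op: "open (U \<times> (UNIV :: real set))" using U by (intro open_Times) auto
  have cD: "continuous_on (U \<times> UNIV) (\<lambda>x. D (fst x))"
    by (intro continuous_on_compose2[OF D] continuous_intros) auto
  have cg': "continuous_on (U \<times> UNIV) (\<lambda>x. g (fst x))"
    by (intro continuous_on_compose2[OF cg] continuous_intros) auto
  have "open U1"
  proof -
    have "continuous_on (U \<times> UNIV) (\<lambda>x. norm (D (fst x)) * \<bar>snd x\<bar>)"
      by (intro continuous_intros cD)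
    from continuous_open_preimage[OF this op, of "{..<1}"]
    have "open ((U \<times> UNIV) \<inter> (\<lambda>x. norm (D (fst x)) * \<bar>snd x\<bar>) -` {..<1})" by simp
    moreover have "U1 = (U \<times> UNIV) \<inter> (\<lambda>x. norm (D (fst x)) * \<bar>snd x\<bar>) -` {..<1}"
      by (auto simp: U1_def)
    ultimately show ?thesis by simp
  qed
  have "(p, 0) \<in> U1" using U by (simp add: U1_def)
  have dF: "(F has_derivative blinfun_apply (Blinfun (L x))) (at x)" if "x \<in> U1" for x
  proof -
    have x: "fst x \<in> U" using that by (auto simp: U1_def)
    have f: "(fst has_derivative fst) (at x)"
      by (intro bounded_linear_imp_has_derivative bounded_linear_fst)
    have s: "(snd has_derivative snd) (at x)"
      by (intro bounded_linear_imp_has_derivative bounded_linear_snd)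
    show ?thesis
      unfolding bounded_linear_Blinfun_apply[OF bl]
      unfolding F_def L_def
      by (intro has_derivative_Pair has_derivative_add f s has_derivative_scaleR
          has_derivative_compose[OF f g[OF x]] has_derivative_compose[OF f r[OF x]])
  qed
  have cL: "continuous_on U1 (\<lambda>x. Blinfun (L x))"
  proof -
    have "continuous_on (U \<times> UNIV) (\<lambda>x. L x h)" for h
      unfolding L_def by (intro continuous_intros cD cg')
    then have "continuous_on U1 (\<lambda>x. L x h)" for h
      by (rule continuous_on_subset) (auto simp: U1_def)
    then show ?thesis
      by (intro continuous_on_blinfun_componentwise) (simp add: bounded_linear_Blinfun_apply[OF bl])
  qed
  define n where "n = g p"
  \<comment> \<open>Obtained by solving \<open>L (p, 0) (v, s) = h\<close>, that is
    \<open>v + s *\<^sub>R n = fst h\<close> and \<open>n \<bullet> v = snd h\<close>: pairing the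
    first equation with \<open>n\<close> and subtracting the second leaves
    \<open>s * (n \<bullet> n)\<close>, so \<open>s = c h\<close>.\<close>
  define c where "c h = (n \<bullet> fst h - snd h) / (n \<bullet> n)" for h :: "'a \<times> real"
  have blc: "bounded_linear c"
    unfolding c_def
    by (intro bounded_linear_divide bounded_linear_compose[OF bounded_linear_divide] bounded_linear_sub
        bounded_linear_compose[OF bounded_linear_inner_right bounded_linear_fst] bounded_linear_snd)
  have bli: "bounded_linear (\<lambda>h. (fst h - c h *\<^sub>R n, c h))"
    by (intro bounded_linear_Pair bounded_linear_sub bounded_linear_fst blc
        bounded_linear_compose[OF bounded_linear_scaleR_left blc])
  have nn: "n \<bullet> n \<noteq> 0" using p by (simp add: n_def)
  have inv: "Blinfun (\<lambda>h. (fst h - c h *\<^sub>R n, c h)) o\<^sub>L Blinfun (L (p, 0)) = id_blinfun"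
  proof (rule blinfun_eqI)
    fix h :: "'a \<times> real"
    have "c (L (p, 0) h) = snd h"
      using nn by (simp add: c_def L_def n_def[symmetric] inner_add_right field_simps)
    then show "blinfun_apply (Blinfun (\<lambda>h. (fst h - c h *\<^sub>R n, c h)) o\<^sub>L Blinfun (L (p, 0))) h
      = blinfun_apply id_blinfun h"
      by (simp add: bounded_linear_Blinfun_apply[OF bl] bounded_linear_Blinfun_apply[OF bli])
         (simp add: L_def n_def)
  qed
  obtain N V G G' where N: "open N" "N \<subseteq> U1" "(p, 0) \<in> N" and V: "open V" "F (p, 0) \<in> V"
    and hom: "homeomorphism N V F G"
    and dG: "\<And>y. y \<in> V \<Longrightarrow> (G has_derivative (G' y)) (at y)"
    and G': "\<And>y. y \<in> V \<Longrightarrow> G' y = inv (blinfun_apply (Blinfun (L (G y))))"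
    and bij: "\<And>y. y \<in> V \<Longrightarrow> bij (blinfun_apply (Blinfun (L (G y))))"
    by (rule inverse_function_theorem[OF \<open>open U1\<close> dF cL \<open>(p, 0) \<in> U1\<close> inv], assumption) (rule that; assumption)
  have GN: "G y \<in> N" and FG: "F (G y) = y" if "y \<in> V" for y
    using hom that by (auto simp: homeomorphism_def)
  have GF: "G (F x) = x" and FV: "F x \<in> V" if "x \<in> N" for x
    using hom that by (auto simp: homeomorphism_def)
  define W where "W = (\<lambda>z. (z, 0::real)) -` V"
  define \<pi> where "\<pi> z = fst (G (z, 0))" for z
  define \<tau> where "\<tau> z = snd (G (z, 0))" for z
  define P where "P z w = fst (G' (z, 0) (w, 0))" for z w
  define T where "T z w = snd (G' (z, 0) (w, 0))" for z w
  have G_eq: "G (z, 0) = (\<pi> z, \<tau> z)" for z by (simp add: \<pi>_def \<tau>_def)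
  have dGW: "((\<lambda>z. G (z, 0)) has_derivative (\<lambda>w. G' (z, 0) (w, 0))) (at z)" if "z \<in> W" for z
  proof -
    have "((\<lambda>z. (z, 0::real)) has_derivative (\<lambda>w. (w, 0))) (at z)"
      by (intro has_derivative_Pair has_derivative_ident has_derivative_const)
    then show ?thesis
      by (rule has_derivative_compose) (use that dG in \<open>auto simp: W_def\<close>)
  qed
  show ?thesis
  proof
    show "open N" "(p, 0) \<in> N" by fact+
    show "N \<subseteq> U \<times> UNIV" using N by (auto simp: U1_def)
    show "open W" unfolding W_def by (intro open_vimage V continuous_intros)
    show "p \<in> W" using V p by (simp add: W_def F_def)
    show "norm (D x) * \<bar>t\<bar> < 1" if "(x, t) \<in> N" for x t
      using that N by (auto simp: U1_def)
    show "\<pi> (x + t *\<^sub>R g x) = x \<and> \<tau> (x + t *\<^sub>R g x) = t" if "(x, t) \<in> N" "r x = 0" for x t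
      using GF[OF that(1)] that(2) by (simp add: F_def G_eq)
    fix z assume z: "z \<in> W"
    then have zV: "(z, 0) \<in> V" by (simp add: W_def)
    show "(\<pi> z, \<tau> z) \<in> N" using GN[OF zV] by (simp add: G_eq)
    show "\<pi> z + \<tau> z *\<^sub>R g (\<pi> z) = z" "r (\<pi> z) = 0"
      using FG[OF zV] by (simp_all add: G_eq F_def)
    show "(\<pi> has_derivative P z) (at z)" "(\<tau> has_derivative T z) (at z)"
      unfolding \<pi>_def P_def \<tau>_def T_def
      by (intro has_derivative_fst has_derivative_snd dGW z)+
  next
    fix w
    have "continuous_on V G" using hom by (auto simp: homeomorphism_def)
    then have "continuous_on V (\<lambda>y. Blinfun (L (G y)))"
      by (intro continuous_on_compose2[OF cL]) (use GN N in auto)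
    then have "continuous_on V (\<lambda>y. inv (blinfun_apply (Blinfun (L (G y)))) (w, 0))"
      using bij by (rule continuous_on_inverse_derivative)
    then have "continuous_on V (\<lambda>y. G' y (w, 0))"
      using G' by (simp cong: continuous_on_cong)
    then have "continuous_on W (\<lambda>z. G' (z, 0) (w, 0))"
      by (rule continuous_on_compose2) (auto simp: W_def intro!: continuous_intros)
    then show "continuous_on W (\<lambda>z. P z w)"
      unfolding P_def by (intro continuous_intros)
  qed
qed

section \<open>Nearest boundary points\<close>

text \<open>Perturbing \<open>u\<close> to \<open>u + t *\<^sub>R a\<close> extends the inequality
  to the hyperplane orthogonal to \<open>a\<close>. For the part \<open>u\<close> of
  \<open>b\<close> orthogonal to \<open>a\<close> it says \<open>u \<bullet> u \<le> 0\<close>, so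
  \<open>b\<close> is a multiple of \<open>a\<close>; testing with \<open>a\<close> gives the
  sign.\<close>

lemma half_space_subset_imp_opposite:
  fixes a b :: "'a::real_inner"
  assumes ab: "\<And>h. a \<bullet> h > 0 \<Longrightarrow> b \<bullet> h \<le> 0" and "a \<noteq> 0"
  shows "b = - (norm b / norm a) *\<^sub>R a"
proof -
  have le: "b \<bullet> u \<le> 0" if u: "a \<bullet> u = 0" for u
  proof (rule field_le_epsilon)
    fix e :: real assume "e > 0"
    define t where "t = e / (\<bar>b \<bullet> a\<bar> + 1)"
    have t: "t > 0" "t * \<bar>b \<bullet> a\<bar> \<le> e"
      using \<open>e > 0\<close> by (auto simp: t_def field_simps)
    have "b \<bullet> (u + t *\<^sub>R a) \<le> 0"
      using ab[of "u + t *\<^sub>R a"] t u \<open>a \<noteq> 0\<close> by (simp add: inner_right_distrib)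
    moreover have "t * (b \<bullet> a) \<ge> - (t * \<bar>b \<bullet> a\<bar>)"
      using t(1) by (metis abs_ge_minus_self abs_mult abs_of_pos minus_le_iff)
    ultimately show "b \<bullet> u \<le> 0 + e"
      using t by (simp add: inner_right_distrib)
  qed
  define c where "c = (b \<bullet> a) / (a \<bullet> a)"
  have aa: "a \<bullet> a > 0" using \<open>a \<noteq> 0\<close> by simp
  define u where "u = b - c *\<^sub>R a"
  have au: "a \<bullet> u = 0"
    using aa by (simp add: u_def c_def inner_diff_right inner_commute)
  have "b \<bullet> u \<le> 0" using le[OF au] .
  moreover have "b \<bullet> u = u \<bullet> u"
    using au by (simp add: u_def inner_diff_left inner_diff_right inner_commute algebra_simps)
  ultimately have "u = 0" by (metis inner_eq_zero_iff inner_ge_zero order_antisym)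
  then have b: "b = c *\<^sub>R a" by (simp add: u_def)
  have "b \<bullet> a \<le> 0" using ab[of a] aa by simp
  then have "c \<le> 0" using aa by (simp add: c_def divide_nonpos_pos)
  then have "norm b / norm a = - c" using b \<open>a \<noteq> 0\<close> by simp
  then show ?thesis using b by simp
qed

text \<open>A direction \<open>h\<close> with \<open>(z - q) \<bullet> h > 0\<close> enters the ball
  at \<open>q\<close>, where \<open>r\<close> does not exceed \<open>r q\<close>; hence
  \<open>g \<bullet> h\<close> cannot be positive, and \<open>g\<close> is opposite to
  \<open>z - q\<close>.\<close>

lemma interior_ball_gradient:
  fixes g :: "'a::real_inner"
  assumes r: "(r has_derivative (\<lambda>h. g \<bullet> h)) (at q)"
    and U: "open U" "q \<in> U" and zq: "z \<noteq> q"
    and le: "\<And>y. y \<in> U \<Longrightarrow> y \<in> ball z (dist z q) \<Longrightarrow> r y \<le> r q"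
  shows "g = - (norm g / dist z q) *\<^sub>R (z - q)"
  unfolding dist_norm
proof (rule half_space_subset_imp_opposite)
  show "z - q \<noteq> 0" using zq by simp
  fix h assume h: "(z - q) \<bullet> h > 0"
  show "g \<bullet> h \<le> 0"
  proof (rule ccontr)
    assume "\<not> g \<bullet> h \<le> 0"
    have "((\<lambda>t. q + t *\<^sub>R h) has_derivative (\<lambda>t. t *\<^sub>R h)) (at (0::real))"
      by (auto intro!: derivative_eq_intros)
    from has_derivative_compose[OF this, of r "\<lambda>h. g \<bullet> h"] r
    have "((\<lambda>t. r (q + t *\<^sub>R h)) has_field_derivative g \<bullet> h) (at 0)"
      by (simp add: has_field_derivative_def mult_commute_abs)
    then obtain d1 where d1: "d1 > 0" "\<And>t. 0 < t \<Longrightarrow> t < d1 \<Longrightarrow> r q < r (q + t *\<^sub>R h)"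
      using DERIV_pos_inc_right[of "\<lambda>t. r (q + t *\<^sub>R h)" "g \<bullet> h" 0] \<open>\<not> g \<bullet> h \<le> 0\<close> by auto
    obtain d2 where d2: "d2 > 0" "ball q d2 \<subseteq> U"
      using U by (auto simp: open_contains_ball)
    have hn: "norm h > 0" using h by auto
    \<comment> \<open>The three bounds make \<open>r\<close> exceed \<open>r q\<close>, keep the
      point in \<open>U\<close>, and keep it in the ball; the last one is the midpoint of the chord
      through \<open>q\<close> in direction \<open>h\<close>.\<close>
    define t where "t = min (d1 / 2) (min (d2 / (2 * norm h)) ((z - q) \<bullet> h / (h \<bullet> h)))"
    have t: "t > 0" "t < d1"
      using d1(1) d2(1) hn h by (auto simp: t_def)
    have "t * norm h \<le> d2 / (2 * norm h) * norm h"
      unfolding t_def by (intro mult_right_mono) auto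
    then have "q + t *\<^sub>R h \<in> U"
      using d2 hn t(1) by (intro subsetD[OF d2(2)]) (auto simp: dist_norm)
    moreover have "q + t *\<^sub>R h \<in> ball z (dist z q)"
    proof -
      have "t * (h \<bullet> h) \<le> (z - q) \<bullet> h / (h \<bullet> h) * (h \<bullet> h)"
        unfolding t_def by (intro mult_right_mono) auto
      then have "t * (h \<bullet> h) \<le> (z - q) \<bullet> h" using hn by simp
      then have "t * (t * (h \<bullet> h) - 2 * ((z - q) \<bullet> h)) < 0"
        using h t(1) by (intro mult_pos_neg) auto
      moreover have "(norm (z - (q + t *\<^sub>R h)))\<^sup>2 = (norm (z - q))\<^sup>2 + t * (t * (h \<bullet> h) - 2 * ((z - q) \<bullet> h))"
        by (simp add: power2_norm_eq_inner inner_diff_left inner_diff_right inner_add_left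
            inner_add_right inner_commute algebra_simps)
      ultimately have "(norm (z - (q + t *\<^sub>R h)))\<^sup>2 < (norm (z - q))\<^sup>2" by simp
      then show ?thesis by (simp add: dist_norm power2_less_imp_less)
    qed
    ultimately have "r (q + t *\<^sub>R h) \<le> r q" by (rule le)
    then show False using d1(2)[OF t] by simp
  qed
qed

text \<open>The distance to the closed frontier is attained. A ball about a point of
  \<open>S\<close> that left \<open>S\<close> would, being connected, meet the frontier at a point
  closer than \<open>q\<close>.\<close>

lemma nearest_frontier_point:
  fixes S :: "'a::{real_normed_vector, heine_borel} set"
  assumes "frontier S \<noteq> {}"
  obtains q where "q \<in> frontier S" "infdist z (frontier S) = dist z q"
    "z \<in> S \<Longrightarrow> ball z (dist z q) \<subseteq> S"
proof -
  obtain q where q: "q \<in> frontier S" "\<And>y. y \<in> frontier S \<Longrightarrow> dist z q \<le> dist z y"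
    using distance_attains_inf[OF frontier_closed assms, of z] by metis
  show ?thesis
  proof
    show "q \<in> frontier S" by fact
    show "infdist z (frontier S) = dist z q"
      using q assms by (intro antisym infdist_le) (auto simp: infdist_notempty intro!: cINF_greatest)
    show "ball z (dist z q) \<subseteq> S" if "z \<in> S"
    proof (rule ccontr)
      assume n: "\<not> ball z (dist z q) \<subseteq> S"
      then have "z \<in> ball z (dist z q)" by auto
      then have "ball z (dist z q) \<inter> S \<noteq> {}" "ball z (dist z q) - S \<noteq> {}" using n that by blast+
      then have "ball z (dist z q) \<inter> frontier S \<noteq> {}"
        by (intro connected_Int_frontier connected_ball)
      then show False using q(2) by force
    qed
  qed
qed

text \<open>A frontier point is outside the open set \<open>\<Omega>\<close>, so \<open>r\<close> is
  not negative there. A positive value would persist nearby, although points of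
  \<open>\<Omega>\<close> accumulate at \<open>q\<close>.\<close>

lemma local_defining_function_frontier:
  assumes \<Omega>: "open \<Omega>" and r: "local_defining_function \<Omega> p U r" and q: "q \<in> frontier \<Omega>" "q \<in> U"
  shows "r q = 0"
proof (rule antisym)
  have U: "open U" "U \<inter> \<Omega> = {z \<in> U. r z < 0}" and "continuous_on U r"
    using r by (auto simp: local_defining_function_def smooth_on_def dest: spec[of _ 0])
  show "0 \<le> r q"
    using q U(2) frontier_disjoint_eq[of \<Omega>] \<Omega> by force
  show "r q \<le> 0"
  proof (rule ccontr)
    assume n: "\<not> r q \<le> 0"
    have "open (U \<inter> r -` {0<..})"
      using \<open>continuous_on U r\<close> U(1) by (intro continuous_open_preimage) auto
    moreover have "q \<in> U \<inter> r -` {0<..}" "q \<in> closure \<Omega>"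
      using q n by (auto simp: frontier_def)
    ultimately have "U \<inter> r -` {0<..} \<inter> \<Omega> \<noteq> {}"
      by (metis open_Int_closure_eq_empty disjoint_iff)
    then show False using U(2) by force
  qed
qed

lemma inner_grad_eq: "grad f x \<bullet> h = (\<Sum>b\<in>Basis. partial_deriv b f x * (h \<bullet> b))"
  by (simp add: grad_def inner_sum_left inner_commute[of h])

section \<open>Convexity of the signed distance\<close>

text \<open>The radial part of \<open>f' h\<close> changes only the length of \<open>f x\<close>, so
  it is projected away. This differentiates the unit normal field.\<close>

lemma has_derivative_sgn:
  fixes f :: "'a::real_normed_vector \<Rightarrow> 'b::real_inner"
  assumes f: "(f has_derivative f') (at x)" and nz: "f x \<noteq> 0"
  shows "((\<lambda>x. sgn (f x)) has_derivative
    (\<lambda>h. (f' h - (sgn (f x) \<bullet> f' h) *\<^sub>R sgn (f x)) /\<^sub>R norm (f x))) (at x)"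
proof -
  have "((\<lambda>x. norm (f x)) has_derivative (\<lambda>h. f' h \<bullet> sgn (f x))) (at x)"
    using has_derivative_compose[OF f has_derivative_norm[OF nz]] by simp
  from has_derivative_scaleR[OF Deriv.has_derivative_inverse[OF _ this] f] nz
  have "((\<lambda>x. f x /\<^sub>R norm (f x)) has_derivative
     (\<lambda>h. inverse (norm (f x)) *\<^sub>R f' h
       + (- (inverse (norm (f x)) * (f' h \<bullet> sgn (f x)) * inverse (norm (f x)))) *\<^sub>R f x)) (at x)"
    by simp
  then show ?thesis
    unfolding sgn_div_norm
    by (rule has_derivative_eq_rhs) (simp add: fun_eq_iff algebra_simps inner_commute)
qed

text \<open>The second factor is the increment of \<open>z\<close> split along normal coordinates.
  As \<open>X\<close> is orthogonal to \<open>u\<close>, the product equals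
  \<open>A V \<bullet> V + t * (X \<bullet> X)\<close>; positivity at the tangent vector
  \<open>V + t *\<^sub>R X\<close> absorbs the negative term.\<close>

lemma tangential_part_nonneg:
  fixes A :: "'a::real_inner \<Rightarrow>\<^sub>L 'a"
  assumes sym: "\<And>x y. A x \<bullet> y = A y \<bullet> x"
    and psd: "\<And>x. u \<bullet> x = 0 \<Longrightarrow> A x \<bullet> x \<ge> 0"
    and u: "u \<bullet> u = 1" and V: "u \<bullet> V = 0"
    and t: "t \<le> 0" "norm A * \<bar>t\<bar> \<le> 1"
  shows "(A V - (u \<bullet> A V) *\<^sub>R u) \<bullet> (V + c *\<^sub>R u + t *\<^sub>R A V) \<ge> 0"
proof -
  define X where "X = A V - (u \<bullet> A V) *\<^sub>R u"
  have uX: "u \<bullet> X = 0" using u by (simp add: X_def inner_diff_right)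
  have AVX: "A V \<bullet> X = X \<bullet> X"
    using uX by (simp add: X_def inner_diff_left inner_diff_right inner_commute algebra_simps)
  have "0 \<le> A (V + t *\<^sub>R X) \<bullet> (V + t *\<^sub>R X)"
    by (rule psd) (simp add: inner_add_right V uX)
  also have "\<dots> = A V \<bullet> V + 2 * t * (X \<bullet> X) + t * (t * (A X \<bullet> X))"
    using sym[of X V] by (simp add: blinfun.bilinear_simps inner_add_left inner_add_right AVX distrib_left)
  \<comment> \<open>One factor \<open>\<bar>t\<bar>\<close> is spent against \<open>norm A\<close>;
    the other remains and, since \<open>t \<le> 0\<close>, equals \<open>- t\<close>.\<close>
  also have "t * (t * (A X \<bullet> X)) \<le> - t * (X \<bullet> X)"
  proof -
    have "A X \<bullet> X \<le> norm (A X) * norm X" by (rule norm_cauchy_schwarz)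
    also have "\<dots> \<le> norm A * norm X * norm X" by (intro mult_right_mono norm_blinfun) auto
    finally have "\<bar>t\<bar> * (A X \<bullet> X) \<le> \<bar>t\<bar> * (norm A * norm X * norm X)"
      by (intro mult_left_mono) auto
    also have "\<dots> = (norm A * \<bar>t\<bar>) * (X \<bullet> X)" by (simp add: dot_square_norm power2_eq_square)
    also have "\<dots> \<le> 1 * (X \<bullet> X)" by (intro mult_right_mono t) auto
    finally have "\<bar>t\<bar> * (\<bar>t\<bar> * (A X \<bullet> X)) \<le> \<bar>t\<bar> * (X \<bullet> X)" by (intro mult_left_mono) auto
    then show ?thesis using t by (simp add: abs_if split: if_splits)
  qed
  finally have "0 \<le> A V \<bullet> V + t * (X \<bullet> X)" by simp
  also have "A V \<bullet> V = X \<bullet> V" using V by (simp add: X_def inner_diff_left)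
  also have "X \<bullet> V + t * (X \<bullet> X) = X \<bullet> (V + c *\<^sub>R u + t *\<^sub>R A V)"
    using uX AVX by (simp add: inner_add_right inner_commute)
  finally show ?thesis by (simp add: X_def)
qed

lemma signed_distance_convex_near:
  fixes \<Omega> :: "'a::euclidean_space set"
  assumes \<Omega>: "open \<Omega>" and p: "p \<in> frontier \<Omega>" and ldf: "local_defining_function \<Omega> p U r"
    and conv: "\<And>q V. q \<in> frontier \<Omega> \<inter> U \<Longrightarrow> V \<in> real_tangent_space r q \<Longrightarrow> real_Hessian r q V V \<ge> 0"
  obtains e where "e > 0"
    "\<And>z. z \<in> ball p e \<inter> \<Omega> \<Longrightarrow> convex_function_at (signed_distance \<Omega>) z"
proof -
  define g where "g = grad r"
  have U: "open U" "p \<in> U" "U \<inter> \<Omega> = {z \<in> U. r z < 0}" and g0: "\<And>x. x \<in> U \<Longrightarrow> g x \<noteq> 0" and "Ck_on 2 r U"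
    using ldf by (auto simp: local_defining_function_def smooth_on_def g_def)
  obtain D :: "'a \<Rightarrow> 'a \<Rightarrow>\<^sub>L 'a"
    where dr: "\<And>x. x \<in> U \<Longrightarrow> (r has_derivative (\<lambda>h. g x \<bullet> h)) (at x)"
      and dg: "\<And>x. x \<in> U \<Longrightarrow> (g has_derivative D x) (at x)"
      and cD: "continuous_on U D"
    unfolding g_def by (rule Ck_on_2E[OF U(1) \<open>Ck_on 2 r U\<close>]) blast
  have hess: "real_Hessian r x A B = D x A \<bullet> B" if "x \<in> U" for x A B
    by (rule Ck_on_2I(2)[OF U(1) dr dg _ that]) (auto intro!: continuous_intros cD)
  have sym: "D x h \<bullet> k = D x k \<bullet> h" if "x \<in> U" for x h k
    by (rule second_derivative_symmetric[OF U(1) that dr dg cD])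
  have cg: "continuous_on U g"
    using dg has_derivative_continuous by (blast intro: continuous_at_imp_continuous_on)
  have r0: "r q = 0" if "q \<in> frontier \<Omega>" "q \<in> U" for q
    using local_defining_function_frontier[OF \<Omega> ldf that] .
  obtain N W \<pi> \<tau> P T where N: "open N" "(p, 0) \<in> N" "N \<subseteq> U \<times> UNIV" and W: "open W" "p \<in> W"
    and N1: "\<And>x t. (x, t) \<in> N \<Longrightarrow> norm (D x) * \<bar>t\<bar> < 1"
    and N2: "\<And>x t. (x, t) \<in> N \<Longrightarrow> r x = 0 \<Longrightarrow> \<pi> (x + t *\<^sub>R g x) = x \<and> \<tau> (x + t *\<^sub>R g x) = t"
    and W1: "\<And>z. z \<in> W \<Longrightarrow> (\<pi> z, \<tau> z) \<in> N"
    and W2: "\<And>z. z \<in> W \<Longrightarrow> \<pi> z + \<tau> z *\<^sub>R g (\<pi> z) = z"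
    and W3: "\<And>z. z \<in> W \<Longrightarrow> r (\<pi> z) = 0"
    and d\<pi>: "\<And>z. z \<in> W \<Longrightarrow> (\<pi> has_derivative P z) (at z)"
    and d\<tau>: "\<And>z. z \<in> W \<Longrightarrow> (\<tau> has_derivative T z) (at z)"
    and cP: "\<And>w. continuous_on W (\<lambda>z. P z w)"
    by (rule normal_coordinates[OF U(1,2) dr dg cD r0[OF p U(2)] g0[OF U(2)]], assumption, assumption)
       (rule that; assumption)
  define m where "m = norm (g p) / 2"
  have m: "m > 0" using g0[OF U(2)] by (simp add: m_def)
  obtain e1 where e1: "e1 > 0" "ball p e1 \<subseteq> W" using W by (auto simp: open_contains_ball)
  have "isCont g p" using cg U by (simp add: continuous_on_eq_continuous_at)
  then obtain e2 where e2: "e2 > 0" "\<And>x. dist x p < e2 \<Longrightarrow> dist (g x) (g p) < m"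
    using m unfolding continuous_at_eps_delta by blast
  obtain A B where AB: "open A" "open B" "(p, 0) \<in> A \<times> B" "A \<times> B \<subseteq> N"
    using N by (metis open_prod_elim)
  obtain e3 where e3: "e3 > 0" "ball p e3 \<subseteq> A" using AB by (auto simp: open_contains_ball)
  obtain e4 where e4: "e4 > 0" "ball 0 e4 \<subseteq> B" using AB by (auto simp: open_contains_ball)
  \<comment> \<open>\<open>e1\<close> keeps \<open>z\<close> in \<open>W\<close>. A nearest point
    \<open>q\<close> is within \<open>2 * e\<close> of \<open>p\<close>, hence the halves of
    \<open>e2\<close> and \<open>e3\<close>, which give \<open>m < norm (g q)\<close> and
    \<open>q \<in> A\<close>. The bound \<open>e4 * m\<close> then yields
    \<open>\<bar>t\<bar> < e4\<close>.\<close>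
  define e where "e = min e1 (min (e2 / 2) (min (e3 / 2) (e4 * m)))"
  have e: "e > 0" using e1 e2 e3 e4 m by (simp add: e_def)
  define S where "S = ball p e \<inter> \<Omega>"
  have S: "open S" "S \<subseteq> W" using \<Omega> e1 by (auto simp: S_def e_def)
  \<comment> \<open>At a nearest point \<open>q\<close> the gradient is opposite to
    \<open>z - q\<close>, so \<open>z = q + t *\<^sub>R g q\<close> with \<open>t < 0\<close>; since
    \<open>(q, t)\<close> lies in \<open>N\<close>, it must be
    \<open>(\<pi> z, \<tau> z)\<close>.\<close>
  have key: "\<pi> z \<in> frontier \<Omega> \<and> infdist z (frontier \<Omega>) = norm (z - \<pi> z) \<and> \<tau> z < 0" if z: "z \<in> S" for z
  proof -
    have z': "dist z p < e" "z \<in> \<Omega>" using z by (auto simp: S_def dist_commute)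
    obtain q where q: "q \<in> frontier \<Omega>" "infdist z (frontier \<Omega>) = dist z q" "ball z (dist z q) \<subseteq> \<Omega>"
      using nearest_frontier_point[of \<Omega> z] p z' by blast
    have "dist z q \<le> dist z p" using infdist_le[OF p, of z] q by simp
    then have zq: "dist z q < e" and qp: "dist q p < 2 * e"
      using z' dist_triangle3[of q p z] by auto
    have "q \<in> A" using qp e3 by (intro subsetD[OF e3(2)]) (auto simp: e_def dist_commute)
    moreover have "0 \<in> B" using AB by simp
    ultimately have "q \<in> U" using AB N by blast
    have ne: "z \<noteq> q" using q(1) z'(2) \<Omega> frontier_disjoint_eq[of \<Omega>] by auto
    have eq: "g q = - (norm (g q) / dist z q) *\<^sub>R (z - q)"
    proof (rule interior_ball_gradient[OF dr[OF \<open>q \<in> U\<close>] U(1) \<open>q \<in> U\<close> ne])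
      fix y assume "y \<in> U" "y \<in> ball z (dist z q)"
      then show "r y \<le> r q" using q(3) U(3) r0[OF q(1) \<open>q \<in> U\<close>] by force
    qed
    define t where "t = - (dist z q / norm (g q))"
    have "t *\<^sub>R g q = z - q"
      by (subst eq) (use ne g0[OF \<open>q \<in> U\<close>] in \<open>simp add: t_def\<close>)
    then have zt: "z = q + t *\<^sub>R g q" by simp
    have "m < norm (g q)"
    proof -
      have "dist (g q) (g p) < m" using qp by (intro e2) (auto simp: e_def)
      then show ?thesis using norm_triangle_ineq2[of "g p" "g q"] by (simp add: m_def dist_norm norm_minus_commute)
    qed
    then have "dist z q / norm (g q) \<le> dist z q / m"
      using m by (intro divide_left_mono mult_pos_pos) auto
    also have "\<dots> < e / m" using zq m by (simp add: divide_strict_right_mono)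
    also have "\<dots> \<le> e4" using m by (simp add: e_def divide_le_eq)
    finally have "t \<in> B" by (intro subsetD[OF e4(2)]) (simp add: t_def)
    with \<open>q \<in> A\<close> AB have "(q, t) \<in> N" by blast
    from N2[OF this r0[OF q(1) \<open>q \<in> U\<close>]] have "\<pi> z = q" "\<tau> z = t" by (simp_all flip: zt)
    moreover have "t < 0" using ne g0[OF \<open>q \<in> U\<close>] by (simp add: t_def)
    ultimately show ?thesis using q by (simp add: dist_norm)
  qed
  have SW: "z \<in> W" and \<pi>U: "\<pi> z \<in> U" if "z \<in> S" for z
    using S(2) W1[of z] N(3) that by auto
  define u where "u z = sgn (g (\<pi> z))" for z
  define E where "E z h = D (\<pi> z) (P z h)" for z h
  define G where "G z h = (E z h - (u z \<bullet> E z h) *\<^sub>R u z) /\<^sub>R norm (g (\<pi> z))" for z h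
  have dg\<pi>: "((\<lambda>z. g (\<pi> z)) has_derivative E z) (at z)" if "z \<in> S" for z
    unfolding E_def[abs_def] using has_derivative_compose[OF d\<pi>[OF SW] dg[OF \<pi>U]] that by simp
  have du: "(u has_derivative G z) (at z)" if "z \<in> S" for z
    unfolding u_def[abs_def] G_def[abs_def]
    using has_derivative_sgn[OF dg\<pi>] g0[OF \<pi>U] that by simp
  \<comment> \<open>\<open>r\<close> vanishes along \<open>\<pi>\<close>, so the derivative of
    \<open>\<pi>\<close> takes tangential values.\<close>
  have gP: "g (\<pi> z) \<bullet> P z h = 0" if "z \<in> S" for z h
  proof -
    have "((\<lambda>z. r (\<pi> z)) has_derivative (\<lambda>h. g (\<pi> z) \<bullet> P z h)) (at z)"
      using has_derivative_compose[OF d\<pi>[OF SW] dr[OF \<pi>U]] that by simp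
    moreover have "((\<lambda>z. r (\<pi> z)) has_derivative (\<lambda>h. 0)) (at z)"
      by (rule has_derivative_transform_within_open[OF has_derivative_const S(1) that]) (simp add: W3 SW)
    ultimately show ?thesis by (metis has_derivative_unique)
  qed
  have ident: "h = P z h + (T z h * norm (g (\<pi> z))) *\<^sub>R u z + \<tau> z *\<^sub>R D (\<pi> z) (P z h)" if "z \<in> S" for z h
  proof -
    have "((\<lambda>z. \<pi> z + \<tau> z *\<^sub>R g (\<pi> z)) has_derivative
        (\<lambda>h. P z h + (\<tau> z *\<^sub>R E z h + T z h *\<^sub>R g (\<pi> z)))) (at z)"
      using that by (intro has_derivative_add has_derivative_scaleR d\<pi> d\<tau> dg\<pi> SW)
    moreover have "((\<lambda>z. \<pi> z + \<tau> z *\<^sub>R g (\<pi> z)) has_derivative (\<lambda>h. h)) (at z)"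
      by (rule has_derivative_transform_within_open[OF has_derivative_ident S(1) that]) (simp add: W2 SW)
    ultimately have "(\<lambda>h. P z h + (\<tau> z *\<^sub>R E z h + T z h *\<^sub>R g (\<pi> z))) = (\<lambda>h. h)"
      by (rule has_derivative_unique)
    then have "P z h + (\<tau> z *\<^sub>R E z h + T z h *\<^sub>R g (\<pi> z)) = h" by metis
    moreover have "(T z h * norm (g (\<pi> z))) *\<^sub>R u z = T z h *\<^sub>R g (\<pi> z)"
      using g0[OF \<pi>U[OF that]] by (simp add: u_def sgn_div_norm)
    ultimately show ?thesis by (simp add: E_def add_ac)
  qed
  \<comment> \<open>On \<open>S\<close> the function is \<open>- norm (z - \<pi> z)\<close>. Since
    \<open>\<tau> z < 0\<close>, the direction of \<open>z - \<pi> z\<close> is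
    \<open>- u z\<close>, and the motion of the foot drops out of the derivative because it is
    tangential.\<close>
  have d\<delta>: "(signed_distance \<Omega> has_derivative (\<lambda>h. u z \<bullet> h)) (at z)" if z: "z \<in> S" for z
  proof -
    have zp: "z - \<pi> z = \<tau> z *\<^sub>R g (\<pi> z)" using W2[OF SW[OF z]] by (simp add: algebra_simps)
    have nz: "z - \<pi> z \<noteq> 0" unfolding zp using key[OF z] g0[OF \<pi>U[OF z]] by simp
    have sg: "sgn (z - \<pi> z) = - u z"
      unfolding zp using key[OF z] by (simp add: u_def sgn_scaleR)
    have "((\<lambda>z. z - \<pi> z) has_derivative (\<lambda>h. h - P z h)) (at z)"
      by (intro has_derivative_diff has_derivative_ident d\<pi> SW z)
    from has_derivative_minus[OF has_derivative_compose[OF this has_derivative_norm[OF nz]]]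
    have "((\<lambda>z. - norm (z - \<pi> z)) has_derivative (\<lambda>h. u z \<bullet> h)) (at z)"
      using gP[OF z] by (simp add: sg inner_diff_left) (simp add: u_def sgn_div_norm inner_commute)
    then show ?thesis
      by (rule has_derivative_transform_within_open[OF _ S(1) z])
         (use key in \<open>auto simp: signed_distance_def S_def\<close>)
  qed
  have cG: "continuous_on S (\<lambda>z. G z h)" for h
  proof -
    have c\<pi>: "continuous_on S \<pi>"
      using d\<pi> SW has_derivative_continuous by (blast intro: continuous_at_imp_continuous_on)
    have "continuous_on S (\<lambda>z. D (\<pi> z))" "continuous_on S (\<lambda>z. g (\<pi> z))"
      using \<pi>U by (auto intro!: continuous_on_compose2[OF cD c\<pi>] continuous_on_compose2[OF cg c\<pi>])
    then show ?thesis
      unfolding G_def E_def u_def sgn_div_norm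
      using g0 \<pi>U by (intro continuous_intros continuous_on_subset[OF cP S(2)]) auto
  qed
  have C2: "Ck_on 2 (signed_distance \<Omega>) S"
    by (rule Ck_on_2I(1)[OF S(1) d\<delta> du cG])
  have hess\<delta>: "real_Hessian (signed_distance \<Omega>) z h h = G z h \<bullet> h" if "z \<in> S" for z h
    by (rule Ck_on_2I(2)[OF S(1) d\<delta> du cG that])
  have nonneg: "real_Hessian (signed_distance \<Omega>) z h h \<ge> 0" if z: "z \<in> S" for z h
  proof -
    have g: "g (\<pi> z) \<noteq> 0" using g0 \<pi>U z by simp
    have perp: "u z \<bullet> x = 0 \<longleftrightarrow> g (\<pi> z) \<bullet> x = 0" for x using g by (simp add: u_def sgn_div_norm)
    \<comment> \<open>By \<open>ident\<close> the second factor is \<open>h\<close> itself, so this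
      is \<open>G z h \<bullet> h\<close> up to the positive factor
      \<open>norm (g (\<pi> z))\<close>.\<close>
    have "(E z h - (u z \<bullet> E z h) *\<^sub>R u z) \<bullet> (P z h + (T z h * norm (g (\<pi> z))) *\<^sub>R u z + \<tau> z *\<^sub>R E z h) \<ge> 0"
      unfolding E_def
    proof (rule tangential_part_nonneg)
      show "D (\<pi> z) x \<bullet> y = D (\<pi> z) y \<bullet> x" for x y by (rule sym[OF \<pi>U[OF z]])
      show "D (\<pi> z) x \<bullet> x \<ge> 0" if "u z \<bullet> x = 0" for x
        using conv[of "\<pi> z" x] that key[OF z] \<pi>U[OF z]
        by (simp add: hess perp real_tangent_space_def g_def inner_grad_eq)
      show "u z \<bullet> u z = 1" using g by (simp add: u_def norm_sgn flip: norm_eq_1)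
      show "u z \<bullet> P z h = 0" using gP[OF z] by (simp add: perp)
      show "\<tau> z \<le> 0" using key[OF z] by simp
      show "norm (D (\<pi> z)) * \<bar>\<tau> z\<bar> \<le> 1" using N1[OF W1[OF SW[OF z]]] by simp
    qed
    then have "(E z h - (u z \<bullet> E z h) *\<^sub>R u z) \<bullet> h \<ge> 0"
      using ident[OF z, of h] by (simp add: E_def)
    then have "G z h \<bullet> h \<ge> 0" by (simp add: G_def)
    then show ?thesis using hess\<delta>[OF z] by simp
  qed
  show ?thesis
  proof
    show "e > 0" by fact
    show "convex_function_at (signed_distance \<Omega>) z" if "z \<in> ball p e \<inter> \<Omega>" for z
      unfolding convex_function_at_def using S(1) C2 nonneg that by (auto simp: S_def)
  qed
qed

theorem theorem5p1:
  fixes \<Omega> :: "(complex ^ 'n) set"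
  assumes "smoothly_bounded_domain \<Omega>" and "convex_domain \<Omega>"
  shows "\<exists>U. open U \<and> frontier \<Omega> \<subseteq> U \<and>
           (\<forall>z \<in> U \<inter> \<Omega>. convex_function_at (signed_distance \<Omega>) z \<and>
              (\<forall>W. real_Hessian (signed_distance \<Omega>) z W W \<ge> 0))"
proof -
  have \<Omega>: "open \<Omega>" using assms(1) by (simp add: smoothly_bounded_domain_def)
  have "\<exists>e>0. \<forall>z\<in>ball p e \<inter> \<Omega>. convex_function_at (signed_distance \<Omega>) z" if p: "p \<in> frontier \<Omega>" for p
  proof -
    obtain U r where "local_defining_function \<Omega> p U r"
      "\<forall>q \<in> frontier \<Omega> \<inter> U. \<forall>V \<in> real_tangent_space r q. real_Hessian r q V V \<ge> 0"
      using assms(2) p unfolding convex_domain_def by blast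
    with signed_distance_convex_near[OF \<Omega> p, of U r] show ?thesis by metis
  qed
  then obtain e where e: "\<And>p. p \<in> frontier \<Omega> \<Longrightarrow> e p > 0"
    "\<And>p z. p \<in> frontier \<Omega> \<Longrightarrow> z \<in> ball p (e p) \<inter> \<Omega> \<Longrightarrow> convex_function_at (signed_distance \<Omega>) z"
    by metis
  \<comment> \<open>The neighbourhood is the union of the balls chosen at the boundary points; the
    Hessian bound at \<open>z\<close> is contained in convexity near \<open>z\<close>.\<close>
  have "convex_function_at (signed_distance \<Omega>) z \<and> (\<forall>W. real_Hessian (signed_distance \<Omega>) z W W \<ge> 0)"
    if "z \<in> (\<Union>p\<in>frontier \<Omega>. ball p (e p)) \<inter> \<Omega>" for z
    using e(2) that unfolding convex_function_at_def by blast
  moreover have "frontier \<Omega> \<subseteq> (\<Union>p\<in>frontier \<Omega>. ball p (e p))" using e(1) by force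
  moreover have "open (\<Union>p\<in>frontier \<Omega>. ball p (e p))" by blast
  ultimately show ?thesis by blast
qed

end
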